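(* Let $N\ge 1$ be an integer, let $a_m(x)=\sum_{i=0}^m a_{m,i}x^i$, $m=1,\ldots,N$, be polynomials with complex coefficients (so $\deg a_m\le m$), let $P_n(x)=\sum_{i=0}^n b_{n,i}x^i$ with $b_{n,n}=1$, $n=0,1,2,\ldots$, be a sequence of monic polynomials with complex coefficients, and let $\{\lambda_n\}_{n\ge 0}\subset\mathbb{C}$ with $\lambda_0=0$. Then $$\sum_{i=1}^N a_i(x)\,\frac{d^i}{dx^i}P_n(x)=\lambda_nP_n(x)\quad\text{for all } n\ge 0$$ if and only if $$\sum_{k=0}^N\left[\sum_{i=k}^{m+k}\binom{m+k}{i}\, i!\,a_{i,i-k}\right]b_{n,m+k}=\lambda_n b_{n,m},\qquad n\ge 0,\quad m=0,1,\ldots,n .$$ In particular, if the first family of identities holds, then for every $n\ge 0$ $$\lambda_n=\sum_{i=1}^{\min\{n,N\}}\binom{n}{i}\, i!\,a_{i,i}.$$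
   Context: Conventions: $a_{0,0}=0$ (the differential operator has no zeroth-order term); $a_{i,j}=0$ whenever $i>N$; $b_{n,j}=0$ whenever $j>n$. An empty sum is $0$. *)

theory Defs
  imports Complex_Main "HOL-Computational_Algebra.Polynomial"
begin

end

theory Submission imports Defs
begin

text \<open>
  A polynomial identity is an identity of coefficients, so everything reduces to the
  matrix of the operator \<open>\<Sum>i. a\<^sub>i(x) d\<^sup>i/dx\<^sup>i\<close> in the monomial basis. Since
  \<open>deg a\<^sub>i \<le> i\<close>, multiplying the \<open>i\<close>-th derivative of \<open>x\<^bsup>m+k\<^esup>\<close> by the monomial
  \<open>x\<^bsup>i-k\<^esup>\<close> of \<open>a\<^sub>i\<close> gives \<open>(m+k choose i) i! x\<^sup>m\<close>: the operator never raises the degree, and its \<open>k\<close>-th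
  superdiagonal collects the coefficients \<open>a\<^bsub>i,i-k\<^esub>\<close>. The lemma
  \<open>coeff_differential_operator\<close> is this computation: it groups the contributions to
  \<open>x\<^sup>m\<close> by the amount \<open>k\<close> by which the degree drops rather than by the order \<open>i\<close> of
  the derivative. The recurrence for the \<open>b\<^bsub>n,m\<^esub>\<close> is then literally the comparison of
  the coefficients of \<open>x\<^sup>m\<close> for \<open>m \<le> n\<close>; above degree \<open>n\<close> both sides vanish.
  The formula for \<open>\<lambda>\<^sub>n\<close> is the case \<open>m = n\<close>, where only the diagonal \<open>k = 0\<close>
  meets a nonzero coefficient and \<open>P\<^sub>n\<close> is monic.
\<close>

lemma coeff_sum_monom_atLeast0AtMost:
  "coeff (\<Sum>i=0..n. monom (c i) i) m = (if m \<le> n then c m else 0)"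
  by (auto simp: coeff_sum sum.delta)

lemma pochhammer_Suc_eq_binomial_fact:
  "pochhammer (of_nat (Suc r)) i = (of_nat ((r + i) choose i) * fact i :: 'a :: field_char_0)"
proof -
  have "fact (r + i) = (fact r * pochhammer (of_nat (Suc r)) i :: 'a)"
    using pochhammer_product'[of "1 :: 'a" r i] by (simp add: pochhammer_fact)
  then show ?thesis
    by (simp add: binomial_fact field_simps)
qed

text \<open>
  The summand for \<open>k\<close> is the contribution of the monomial \<open>x\<^bsup>i-k\<^esup>\<close> of the first factor,
  which must be paired with \<open>x\<^bsup>m-(i-k)\<^esup>\<close> in the derivative, that is with \<open>x\<^bsup>m+k\<^esup>\<close> in
  \<open>p\<close>. The condition \<open>i \<le> m + k\<close> says that this exponent \<open>m-(i-k)\<close> is not negative.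
\<close>

lemma coeff_poly_mult_higher_pderiv:
  fixes p :: "'a :: field_char_0 poly"
  shows "coeff ((\<Sum>j=0..i. monom (c j) j) * (pderiv ^^ i) p) m =
    (\<Sum>k | k \<le> i \<and> i \<le> m + k.
       of_nat ((m + k) choose i) * fact i * c (i - k) * coeff p (m + k))"
proof -
  let ?g = "\<lambda>j. c j * (pochhammer (of_nat (Suc (m - j))) i * coeff p (m - j + i))"
  have "coeff ((\<Sum>j=0..i. monom (c j) j) * (pderiv ^^ i) p) m =
      (\<Sum>j\<le>m. if j \<le> i then ?g j else 0)"
    by (auto simp: coeff_mult coeff_sum_monom_atLeast0AtMost coeff_higher_pderiv
             intro!: sum.cong)
  also have "\<dots> = (\<Sum>j | j \<le> m \<and> j \<le> i. ?g j)"
    by (rule sum.mono_neutral_cong_right) auto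
  also have "\<dots> = (\<Sum>k | k \<le> i \<and> i \<le> m + k. ?g (i - k))"
    by (rule sum.reindex_bij_witness[of _ "\<lambda>k. i - k" "\<lambda>j. i - j"]) auto
  also have "\<dots> = (\<Sum>k | k \<le> i \<and> i \<le> m + k.
       of_nat ((m + k) choose i) * fact i * c (i - k) * coeff p (m + k))"
  proof (rule sum.cong[OF refl])
    fix k assume "k \<in> {k. k \<le> i \<and> i \<le> m + k}"
    then have "m - (i - k) + i = m + k" by auto
    then show "?g (i - k) =
        of_nat ((m + k) choose i) * fact i * c (i - k) * coeff p (m + k)"
      by (simp only: pochhammer_Suc_eq_binomial_fact mult_ac)
  qed
  finally show ?thesis .
qed

text \<open>
  Exchanging the two sums turns a sum over the order \<open>i\<close> of the derivative into a sum over
  the degree drop \<open>k\<close>. The hypotheses on \<open>a\<close> let the inner range be \<open>k..m+k\<close>, although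
  only orders between \<open>1\<close> and \<open>N\<close> occur in the operator.
\<close>

lemma coeff_differential_operator:
  fixes p :: "'a :: field_char_0 poly"
  assumes A: "\<And>i. 1 \<le> i \<Longrightarrow> i \<le> N \<Longrightarrow> A i = (\<Sum>j=0..i. monom (a i j) j)"
    and a00: "a 0 0 = 0"
    and a_zero: "\<And>i j. i > N \<Longrightarrow> a i j = 0"
  shows "coeff (\<Sum>i=1..N. A i * (pderiv ^^ i) p) m =
    (\<Sum>k=0..N. (\<Sum>i=k..m+k. of_nat ((m + k) choose i) * fact i * a i (i - k))
       * coeff p (m + k))"
proof -
  let ?t = "\<lambda>i k. of_nat ((m + k) choose i) * fact i * a i (i - k) * coeff p (m + k)"
  have a_order: "i \<le> N" if "a i j \<noteq> 0" for i j
    using a_zero that not_le by blast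
  have "coeff (\<Sum>i=1..N. A i * (pderiv ^^ i) p) m =
      (\<Sum>i=1..N. \<Sum>k | k \<le> i \<and> i \<le> m + k. ?t i k)"
    by (simp add: coeff_sum A coeff_poly_mult_higher_pderiv)
  also have "\<dots> = (\<Sum>i=0..N. \<Sum>k | k \<le> i \<and> i \<le> m + k. ?t i k)"
    by (rule sum.mono_neutral_left) (auto simp: a00 not_le intro!: sum.neutral)
  also have "\<dots> = (\<Sum>i=0..N. \<Sum>k | k \<in> {0..N} \<and> (k \<le> i \<and> i \<le> m + k). ?t i k)"
    by (intro sum.cong refl) auto
  also have "\<dots> = (\<Sum>k=0..N. \<Sum>i | i \<in> {0..N} \<and> (k \<le> i \<and> i \<le> m + k). ?t i k)"
    by (rule sum.swap_restrict) auto
  also have "\<dots> = (\<Sum>k=0..N. \<Sum>i=k..m+k. ?t i k)"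
    by (rule sum.cong[OF refl], rule sum.mono_neutral_left) (auto dest: a_order)
  finally show ?thesis
    by (simp add: sum_distrib_right)
qed

theorem theorem1:
  fixes N :: nat
    and a b :: "nat \<Rightarrow> nat \<Rightarrow> complex"
    and A P :: "nat \<Rightarrow> complex poly"
    and lam :: "nat \<Rightarrow> complex"
  assumes "N \<ge> 1"
    and "\<And>m. 1 \<le> m \<Longrightarrow> m \<le> N \<Longrightarrow> A m = (\<Sum>i=0..m. monom (a m i) i)"
    and "a 0 0 = 0"
    and "\<And>i j. i > N \<Longrightarrow> a i j = 0"
    and "\<And>n. P n = (\<Sum>i=0..n. monom (b n i) i)"
    and "\<And>n. b n n = 1"
    and "\<And>n j. j > n \<Longrightarrow> b n j = 0"
    and "lam 0 = 0"
  shows "((\<forall>n. (\<Sum>i=1..N. A i * (pderiv ^^ i) (P n)) = smult (lam n) (P n)) \<longleftrightarrow>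
          (\<forall>n. \<forall>m\<in>{0..n}.
             (\<Sum>k=0..N. (\<Sum>i=k..m+k. of_nat ((m + k) choose i) * fact i * a i (i - k)) * b n (m + k))
               = lam n * b n m)) \<and>
         ((\<forall>n. (\<Sum>i=1..N. A i * (pderiv ^^ i) (P n)) = smult (lam n) (P n)) \<longrightarrow>
          (\<forall>n. lam n = (\<Sum>i=1..min n N. of_nat (n choose i) * fact i * a i i)))"
proof -
  note A = assms(2) and a00 = assms(3) and a_zero = assms(4)
    and P = assms(5) and b_monic = assms(6) and b_zero = assms(7)
  let ?L = "\<lambda>n. \<Sum>i=1..N. A i * (pderiv ^^ i) (P n)"
  let ?S = "\<lambda>m k. \<Sum>i=k..m+k. of_nat ((m + k) choose i) * fact i * a i (i - k)"
  let ?rec = "\<lambda>n m. (\<Sum>k=0..N. ?S m k * b n (m + k)) = lam n * b n m"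
  have coeff_P: "coeff (P n) m = b n m" for n m
    by (simp add: P coeff_sum_monom_atLeast0AtMost b_zero)
  have coeff_L: "coeff (?L n) m = (\<Sum>k=0..N. ?S m k * b n (m + k))" for n m
    using coeff_differential_operator[of N A a "P n" m, OF A a00 a_zero]
    by (simp only: coeff_P)
  have eigen_iff: "?L n = smult (lam n) (P n) \<longleftrightarrow> (\<forall>m\<in>{0..n}. ?rec n m)" for n
  proof -
    have above: "?rec n m" if "n < m" for m
      using that by (simp add: b_zero)
    have "?L n = smult (lam n) (P n) \<longleftrightarrow> (\<forall>m. ?rec n m)"
      by (simp only: poly_eq_iff coeff_L coeff_smult coeff_P)
    also have "\<dots> \<longleftrightarrow> (\<forall>m\<in>{0..n}. ?rec n m)"
      using above by (meson atLeastAtMost_iff not_le zero_le)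
    finally show ?thesis .
  qed
  have eigenvalue: "lam n = (\<Sum>i=1..min n N. of_nat (n choose i) * fact i * a i i)"
    if "\<forall>m\<in>{0..n}. ?rec n m" for n
  proof -
    have "lam n = (\<Sum>k=0..N. ?S n k * b n (n + k))"
      using that by (simp add: b_monic)
    also have "\<dots> = (\<Sum>k\<in>{0}. ?S n k * b n (n + k))"
      by (rule sum.mono_neutral_right) (auto simp: b_zero)
    also have "\<dots> = (\<Sum>i=0..n. of_nat (n choose i) * fact i * a i i)"
      by (simp add: b_monic)
    also have "\<dots> = (\<Sum>i=1..min n N. of_nat (n choose i) * fact i * a i i)"
      by (rule sum.mono_neutral_right) (auto simp: a00 a_zero not_le not_less_eq_eq)
    finally show ?thesis .
  qed
  show ?thesis
    using eigen_iff eigenvalue by blast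
qed

end
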